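(* Let $K\ge1$, let $f:(\mathbb R^n)^{K+1}\to\mathbb R^n$ be continuous with $f(0,\dots,0)=0$, and let $d$ be a given integer. Suppose there exist polynomials $p_0,p_1,\dots,p_K$ on $\mathbb R^n$ and a constant $\alpha>0$ such that $p_i(0)=0$ for $i=0,\dots,K$ and $$p_0(x_0)-\alpha\|x_0\|^2\in\Sigma_s^d,\qquad p_i(x_i)\in\Sigma_s^d\quad(i=1,\dots,K),$$ $$-\nabla p_0(x_0)^Tf(x_0,x_1,\dots,x_K)-\sum_{i=1}^K\big(p_i(x_0)-p_i(x_i)\big)-\alpha\|x_0\|^2\in\Sigma_s.$$ Then the system $\dot x(t)=f(x(t),x(t-\tau_1),\dots,x(t-\tau_K))$ is globally asymptotically stable for any finite values of the delays $\tau_1,\dots,\tau_K\ge0$.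
   Context: $\Sigma_s$ is the set of polynomials that are finite sums of squares of real polynomials (in the variables involved), and $\Sigma_s^d$ is its subset of polynomials of degree at most $d$. Let $\tau=\max_i\tau_i$ and let $\mathcal C_\tau$ be the space of continuous functions $[-\tau,0]\to\mathbb R^n$ with supremum norm. It is assumed that for each $\phi\in\mathcal C_\tau$ the equation has a unique solution on $[-\tau,\infty)$ with $x=\phi$ on $[-\tau,0]$. Globally asymptotically stable means: every solution is bounded; for every $\varepsilon>0$ there is $\delta>0$ such that $\|\phi\|<\delta$ implies $\sup_{t\ge-\tau}\|x(t)\|<\varepsilon$; and every solution satisfies $\lim_{t\to\infty}x(t)=0$. *)

theory Defs
  imports "HOL-Analysis.Analysis"
begin

section \<open>Sums of squares\<close>

text \<open>Real polynomials are identified with the functions they induce, which is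
  unambiguous over the infinite field of reals. Coefficients are indexed by exponent vectors.\<close>

definition poly_fun_degree_le :: "int \<Rightarrow> (real^'n \<Rightarrow> real) \<Rightarrow> bool" where
  "poly_fun_degree_le d p \<longleftrightarrow>
     (\<exists>c. p = (\<lambda>x. \<Sum>m\<in>{m :: 'n \<Rightarrow> nat. int (\<Sum>i\<in>UNIV. m i) \<le> d}.
                    c m * (\<Prod>i\<in>UNIV. (x $ i) ^ m i)))"

definition sos :: "('a::real_normed_vector \<Rightarrow> real) set" where
  "sos = {p. \<exists>(N::nat) q. (\<forall>j<N. real_polynomial_function (q j)) \<and>
                          p = (\<lambda>x. \<Sum>j<N. (q j x)\<^sup>2)}"

definition sos_le :: "int \<Rightarrow> (real^'n \<Rightarrow> real) set" where
  "sos_le d = {p \<in> sos. poly_fun_degree_le d p}"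

definition gradient :: "('a::real_inner \<Rightarrow> real) \<Rightarrow> 'a \<Rightarrow> 'a" where
  "gradient p x = (THE D. GDERIV p x :> D)"

section \<open>Delay differential equations\<close>

text \<open>The space \<open>(\<real>\<^sup>n)\<^sup>K\<^sup>+\<^sup>1\<close> is represented as \<open>(real^'n) \<times> (real^'n^'k)\<close>: the first component is
  \<open>x\<^sub>0\<close>, the second collects \<open>x\<^sub>1, \<dots>, x\<^sub>K\<close> with \<open>K = CARD('k)\<close>.\<close>

definition max_delay :: "('k::finite \<Rightarrow> real) \<Rightarrow> real" where
  "max_delay \<tau> = Max (range \<tau>)"

text \<open>An initial function is given by a total function, of which only the values on
  \<open>[-r, 0]\<close> matter; likewise only the values of a solution on \<open>[-r, \<infinity>)\<close> matter.\<close>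

definition history :: "real \<Rightarrow> (real \<Rightarrow> real^'n) set" where
  "history r = {\<phi>. continuous_on {-r..0} \<phi>}"

definition history_norm :: "real \<Rightarrow> (real \<Rightarrow> real^'n) \<Rightarrow> real" where
  "history_norm r \<phi> = (SUP s\<in>{-r..0}. norm (\<phi> s))"

text \<open>At \<open>t = 0\<close> the derivative is the right-hand one.\<close>

definition dde_solution ::
  "((real^'n) \<times> (real^'n^'k) \<Rightarrow> real^'n) \<Rightarrow> ('k::finite \<Rightarrow> real) \<Rightarrow>
   (real \<Rightarrow> real^'n) \<Rightarrow> (real \<Rightarrow> real^'n) \<Rightarrow> bool" where
  "dde_solution f \<tau> \<phi> x \<longleftrightarrow>
     continuous_on {- max_delay \<tau>..} x \<and>
     (\<forall>s\<in>{- max_delay \<tau>..0}. x s = \<phi> s) \<and>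
     (\<forall>t\<ge>0. (x has_vector_derivative f (x t, \<chi> i. x (t - \<tau> i))) (at t within {0..}))"

definition dde_well_posed ::
  "((real^'n) \<times> (real^'n^'k) \<Rightarrow> real^'n) \<Rightarrow> ('k::finite \<Rightarrow> real) \<Rightarrow> bool" where
  "dde_well_posed f \<tau> \<longleftrightarrow>
     (\<forall>\<phi>\<in>history (max_delay \<tau>).
        \<exists>x. dde_solution f \<tau> \<phi> x \<and>
            (\<forall>y. dde_solution f \<tau> \<phi> y \<longrightarrow> (\<forall>t\<ge>- max_delay \<tau>. y t = x t)))"

text \<open>The supremum in the second clause is over a bounded set by the first clause.\<close>

definition globally_asymptotically_stable ::
  "((real^'n) \<times> (real^'n^'k) \<Rightarrow> real^'n) \<Rightarrow> ('k::finite \<Rightarrow> real) \<Rightarrow> bool" where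
  "globally_asymptotically_stable f \<tau> \<longleftrightarrow>
     (\<forall>\<phi>\<in>history (max_delay \<tau>). \<forall>x. dde_solution f \<tau> \<phi> x \<longrightarrow>
        bounded (x ` {- max_delay \<tau>..})) \<and>
     (\<forall>\<epsilon>>0. \<exists>\<delta>>0. \<forall>\<phi>\<in>history (max_delay \<tau>). \<forall>x. dde_solution f \<tau> \<phi> x \<longrightarrow>
        history_norm (max_delay \<tau>) \<phi> < \<delta> \<longrightarrow>
        (SUP t\<in>{- max_delay \<tau>..}. norm (x t)) < \<epsilon>) \<and>
     (\<forall>\<phi>\<in>history (max_delay \<tau>). \<forall>x. dde_solution f \<tau> \<phi> x \<longrightarrow>
        (x \<longlongrightarrow> 0) at_top)"

end

theory Submission
  imports Defs
begin

text \<open>The certificate is a recipe for a Lyapunov--Krasovskii functional. Along a solution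
  \<open>x\<close> put
  \<open>V t = p\<^sub>0 (x t) + (\<Sum>i. \<integral> p\<^sub>i (x s) ds over [t - \<tau> i, t])\<close>.
  Differentiating the integrals produces precisely the differences \<open>p\<^sub>i (x t) - p\<^sub>i (x (t - \<tau> i))\<close>
  of the certificate, whatever the lengths of the delays are, so \<open>V' t \<le> - \<alpha> * \<parallel>x t\<parallel>\<^sup>2\<close>; and since the
  \<open>p\<^sub>i\<close> are nonnegative, \<open>V t \<ge> p\<^sub>0 (x t) \<ge> \<alpha> * \<parallel>x t\<parallel>\<^sup>2\<close>. All this is \<open>Krasovskii_functional\<close>.
  Sums of squares enter only through their nonnegativity.

  As \<open>V\<close> decreases, \<open>\<alpha> * \<parallel>x t\<parallel>\<^sup>2 \<le> V 0\<close> for all \<open>t \<ge> 0\<close>. This bounds every solution, and it gives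
  stability because \<open>V 0\<close> is small for a small initial function: each \<open>p\<^sub>i\<close> is continuous and
  vanishes at the origin, and the integrals run over the fixed lengths \<open>\<tau> i\<close>.

  For attractivity, a bounded solution has a bounded derivative, hence is Lipschitz on
  \<open>[0, \<infinity>)\<close>. So whenever \<open>\<parallel>x t\<parallel> \<ge> \<epsilon>\<close>, the norm stays above \<open>\<epsilon> / 2\<close> for a time that does not
  depend on \<open>t\<close>, and \<open>V\<close> loses a fixed amount during that time. A decreasing function that is
  bounded below can do this only finitely often over disjoint time spans
  (\<open>dissipation_imp_tendsto_zero\<close>, an argument in the style of Barbalat's lemma).\<close>

section \<open>Calculus on half-lines\<close>

lemma has_real_derivative_le_imp_diff_le:
  fixes g g' :: "real \<Rightarrow> real"
  assumes "a \<le> b" "{a..b} \<subseteq> S"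
    and der: "\<And>t. t \<in> {a..b} \<Longrightarrow> (g has_real_derivative g' t) (at t within S)"
    and le: "\<And>t. t \<in> {a..b} \<Longrightarrow> g' t \<le> c"
  shows "g b - g a \<le> c * (b - a)"
proof (cases "a = b")
  case False
  then have "a < b" using assms(1) by simp
  have "\<exists>t\<in>{a<..<b}. g b - g a = (*) (g' t) (b - a)"
  proof (rule mvt_simple[OF \<open>a < b\<close>])
    fix t assume "a \<le> t" "t \<le> b"
    then show "(g has_derivative (*) (g' t)) (at t within {a..b})"
      using der[of t] assms(2) has_field_derivative_def has_field_derivative_subset
      by (metis atLeastAtMost_iff)
  qed
  then obtain t where "t \<in> {a<..<b}" "g b - g a = g' t * (b - a)" by blast
  then show ?thesis using le[of t] \<open>a < b\<close> by (simp add: mult_right_mono)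
qed simp

lemma antiderivative_half_line:
  fixes g :: "real \<Rightarrow> real"
  assumes "continuous_on {a..} g"
  obtains G where "\<And>t. t \<ge> a \<Longrightarrow> (G has_real_derivative g t) (at t within {a..})"
proof (rule that)
  fix t assume "t \<ge> a"
  have "((\<lambda>x. integral {a..x} g) has_real_derivative g t) (at t within {a..t + 1})"
    by (rule integral_has_real_derivative)
      (use \<open>t \<ge> a\<close> assms in \<open>auto intro: continuous_on_subset\<close>)
  moreover have "at t within {a..t + 1} = at t within {a..}"
    by (rule at_within_nhd[of _ "{..<t + 1}"]) auto
  ultimately show "((\<lambda>x. integral {a..x} g) has_real_derivative g t) (at t within {a..})"
    by simp
qed

lemma vector_derivative_bound_imp_lipschitz:
  fixes x x' :: "_ \<Rightarrow> 'a::real_normed_vector"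
  assumes der: "\<And>t. t \<ge> a \<Longrightarrow> (x has_vector_derivative x' t) (at t within {a..})"
    and bound: "\<And>t. t \<ge> a \<Longrightarrow> norm (x' t) \<le> L"
    and "s \<ge> a" "t \<ge> a"
  shows "norm (x s - x t) \<le> L * \<bar>s - t\<bar>"
proof -
  have "norm (x s - x t) \<le> L * norm (s - t)"
  proof (rule differentiable_bound)
    show "convex {a..}" by simp
    fix u assume "u \<in> {a..}"
    then show "(x has_derivative (\<lambda>h. h *\<^sub>R x' u)) (at u within {a..})"
      using der by (simp add: has_vector_derivative_def)
    show "onorm (\<lambda>h. h *\<^sub>R x' u) \<le> L"
      by (rule onorm_le) (use bound[of u] \<open>u \<in> {a..}\<close> in
        \<open>simp add: mult.commute[of L] mult_left_mono\<close>)
  qed (use assms in auto)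
  then show ?thesis by simp
qed

text \<open>An excursion of norm at least \<open>\<epsilon>\<close> at time \<open>t\<close> costs \<open>V\<close> at least
  \<open>h * \<alpha> * (\<epsilon> / 2)\<^sup>2\<close> during \<open>[t, t + h]\<close>, where \<open>h\<close> depends only on \<open>\<epsilon>\<close> and the Lipschitz
  constant. Once \<open>V\<close> is closer than this to its infimum, no such excursion is left.\<close>

lemma dissipation_imp_tendsto_zero:
  fixes x :: "real \<Rightarrow> 'a::real_normed_vector" and V V' :: "real \<Rightarrow> real"
  assumes "\<alpha> > 0"
    and der: "\<And>t. t \<ge> 0 \<Longrightarrow> (V has_real_derivative V' t) (at t within {0..})"
    and decay: "\<And>t. t \<ge> 0 \<Longrightarrow> V' t \<le> - \<alpha> * (norm (x t))\<^sup>2"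
    and nonneg: "\<And>t. t \<ge> 0 \<Longrightarrow> 0 \<le> V t"
    and lip: "\<And>s t. s \<ge> 0 \<Longrightarrow> t \<ge> 0 \<Longrightarrow> norm (x s - x t) \<le> L * \<bar>s - t\<bar>"
  shows "(x \<longlongrightarrow> 0) at_top"
proof (rule tendstoI)
  fix \<epsilon> :: real assume "\<epsilon> > 0"
  define M where "M = max L 1"
  have "M > 0" "L \<le> M" by (auto simp: M_def)
  define h where "h = \<epsilon> / (2 * M)"
  have "h > 0" and Mh: "M * h = \<epsilon> / 2" using \<open>\<epsilon> > 0\<close> \<open>M > 0\<close> by (auto simp: h_def)
  define \<gamma> where "\<gamma> = \<alpha> * (\<epsilon> / 2)\<^sup>2 * h"
  have "\<gamma> > 0" using \<open>\<alpha> > 0\<close> \<open>\<epsilon> > 0\<close> \<open>h > 0\<close> by (simp add: \<gamma>_def)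
  have antimono: "V t \<le> V s" if "0 \<le> s" "s \<le> t" for s t
  proof -
    have "V t - V s \<le> 0 * (t - s)"
    proof (rule has_real_derivative_le_imp_diff_le[where S = "{0..}" and g' = V'])
      fix u assume "u \<in> {s..t}"
      then have "V' u \<le> - \<alpha> * (norm (x u))\<^sup>2" using decay that by simp
      also have "\<dots> \<le> 0" using \<open>\<alpha> > 0\<close> by simp
      finally show "V' u \<le> 0" .
    qed (use that der in auto)
    then show ?thesis by simp
  qed
  have bdd: "bdd_below (V ` {0..})" by (rule bdd_belowI[of _ 0]) (use nonneg in auto)
  have "Inf (V ` {0..}) < Inf (V ` {0..}) + \<gamma>" using \<open>\<gamma> > 0\<close> by simp
  then have "\<exists>v\<in>V ` {0..}. v < Inf (V ` {0..}) + \<gamma>" by (intro cInf_lessD) auto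
  then obtain T where "T \<ge> 0" and T: "V T < Inf (V ` {0..}) + \<gamma>" by auto
  have "norm (x t) < \<epsilon>" if "t \<ge> T" for t
  proof (rule ccontr)
    assume "\<not> norm (x t) < \<epsilon>"
    then have big: "norm (x t) \<ge> \<epsilon>" by simp
    have "t \<ge> 0" using that \<open>T \<ge> 0\<close> by simp
    have "V (t + h) - V t \<le> - \<alpha> * (\<epsilon> / 2)\<^sup>2 * (t + h - t)"
    proof (rule has_real_derivative_le_imp_diff_le[where S = "{0..}" and g' = V'])
      fix s assume s: "s \<in> {t..t + h}"
      have "norm (x s - x t) \<le> L * \<bar>s - t\<bar>" using lip[of s t] s \<open>t \<ge> 0\<close> by simp
      also have "\<dots> \<le> M * h"
        by (rule mult_mono) (use s \<open>L \<le> M\<close> \<open>M > 0\<close> in auto)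
      finally have "norm (x s - x t) \<le> \<epsilon> / 2" using Mh by simp
      then have "\<epsilon> / 2 \<le> norm (x s)"
        using big norm_triangle_ineq2[of "x t" "x s"] by (simp add: norm_minus_commute)
      then have "\<alpha> * (\<epsilon> / 2)\<^sup>2 \<le> \<alpha> * (norm (x s))\<^sup>2"
        using \<open>\<alpha> > 0\<close> \<open>\<epsilon> > 0\<close> by (intro mult_left_mono power_mono) auto
      then show "V' s \<le> - \<alpha> * (\<epsilon> / 2)\<^sup>2" using decay[of s] s \<open>t \<ge> 0\<close> by simp
    qed (use \<open>h > 0\<close> \<open>t \<ge> 0\<close> der in auto)
    then have "V (t + h) \<le> V t - \<gamma>" by (simp add: \<gamma>_def)
    also have "V t \<le> V T" using antimono[of T t] that \<open>T \<ge> 0\<close> by simp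
    finally have "V (t + h) < Inf (V ` {0..})" using T by simp
    moreover have "Inf (V ` {0..}) \<le> V (t + h)"
      by (rule cInf_lower[OF _ bdd]) (use \<open>t \<ge> 0\<close> \<open>h > 0\<close> in auto)
    ultimately show False by simp
  qed
  then show "\<forall>\<^sub>F t in at_top. dist (x t) 0 < \<epsilon>"
    unfolding eventually_at_top_linorder dist_norm by auto
qed

section \<open>Polynomials and sums of squares\<close>

lemma sos_nonneg: "p \<in> sos \<Longrightarrow> 0 \<le> p x"
  by (auto simp: sos_def intro: sum_nonneg)

text \<open>By the Riesz representation of linear functionals, the definite description in
  \<^const>\<open>gradient\<close> denotes a vector for every differentiable function.\<close>

lemma GDERIV_gradient:
  fixes p :: "'a::euclidean_space \<Rightarrow> real"
  assumes "p differentiable (at x)"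
  shows "GDERIV p x :> gradient p x"
proof -
  obtain F where F: "(p has_derivative F) (at x)" using assms differentiable_def by blast
  have lin: "linear F" using F has_derivative_linear by blast
  define D where "D = (\<Sum>b\<in>Basis. F b *\<^sub>R b)"
  have "F h = h \<bullet> D" for h
  proof -
    have "F h = F (\<Sum>b\<in>Basis. (h \<bullet> b) *\<^sub>R b)" by (simp add: euclidean_representation)
    also have "\<dots> = (\<Sum>b\<in>Basis. (h \<bullet> b) * F b)"
      by (simp add: linear_sum[OF lin] linear_cmul[OF lin])
    also have "\<dots> = h \<bullet> D" by (simp add: D_def inner_sum_right mult.commute)
    finally show ?thesis .
  qed
  then have "F = (\<lambda>h. h \<bullet> D)" by auto
  then have D: "GDERIV p x :> D" using F by (simp add: gderiv_def)
  show ?thesis unfolding gradient_def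
  proof (rule theI[of "\<lambda>D. GDERIV p x :> D", OF D])
    fix E assume "GDERIV p x :> E"
    then have "(\<lambda>h. h \<bullet> E) = (\<lambda>h. h \<bullet> D)"
      using D unfolding gderiv_def by (intro has_derivative_unique)
    then have "\<forall>h. h \<bullet> E = h \<bullet> D" by (simp add: fun_eq_iff)
    then show "E = D" by (simp only: vector_eq_ldot)
  qed
qed

section \<open>Solutions and their history\<close>

lemma delay_le_max_delay: "\<tau> i \<le> max_delay \<tau>"
  unfolding max_delay_def by simp

lemma norm_le_history_norm:
  assumes "\<phi> \<in> history r" "s \<in> {-r..0}"
  shows "norm (\<phi> s) \<le> history_norm r \<phi>"
proof -
  have "compact ((\<lambda>s. norm (\<phi> s)) ` {-r..0})"
    using assms(1) unfolding history_def
    by (intro compact_continuous_image continuous_intros) auto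
  then have "bdd_above ((\<lambda>s. norm (\<phi> s)) ` {-r..0})"
    by (intro bounded_imp_bdd_above compact_imp_bounded)
  then show ?thesis unfolding history_norm_def using assms(2) by (rule cSUP_upper[rotated])
qed

lemma norm_delayed_state_le:
  fixes x :: "real \<Rightarrow> real^'n" and \<tau> :: "'k::finite \<Rightarrow> real" and R :: real
  assumes "\<And>s. s \<ge> - max_delay \<tau> \<Longrightarrow> norm (x s) \<le> R" "t \<ge> 0" "\<And>i. \<tau> i \<ge> 0"
  shows "norm (x t, \<chi> i. x (t - \<tau> i)) \<le> R + CARD('k) * R"
proof -
  have *: "norm (x (t - \<tau> i)) \<le> R" for i
    using assms(1)[of "t - \<tau> i"] delay_le_max_delay[of \<tau> i] assms(2) by simp
  have "max_delay \<tau> \<ge> 0" by (rule order_trans[OF assms(3) delay_le_max_delay])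
  then have "norm (x t) \<le> R" using assms(1)[of t] assms(2) by simp
  moreover have "norm (\<chi> i. x (t - \<tau> i)) \<le> CARD('k) * R"
  proof -
    have "norm (\<chi> i. x (t - \<tau> i)) \<le> (\<Sum>i\<in>UNIV. norm (x (t - \<tau> i)))"
      unfolding norm_vec_def by (simp add: L2_set_le_sum)
    also have "\<dots> \<le> CARD('k) * R" using sum_bounded_above[of UNIV "\<lambda>i. norm (x (t - \<tau> i))" R] *
      by simp
    finally show ?thesis .
  qed
  ultimately show ?thesis using norm_Pair_le[of "x t" "\<chi> i. x (t - \<tau> i)"] by linarith
qed

section \<open>The Lyapunov--Krasovskii functional\<close>

locale Krasovskii_certificate =
  fixes f :: "(real^'n) \<times> (real^'n^'k) \<Rightarrow> real^'n"
    and \<tau> :: "'k \<Rightarrow> real"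
    and p0 :: "real^'n \<Rightarrow> real"
    and p :: "'k \<Rightarrow> real^'n \<Rightarrow> real"
    and \<alpha> :: real
  assumes f_cont: "continuous_on UNIV f"
    and delay_nonneg: "\<tau> i \<ge> 0"
    and alpha_pos: "\<alpha> > 0"
    and p0_gderiv: "GDERIV p0 y :> gradient p0 y"
    and p_cont: "continuous_on UNIV (p i)"
    and p0_zero: "p0 0 = 0"
    and p_zero: "p i 0 = 0"
    and p0_ge: "\<alpha> * (norm y)\<^sup>2 \<le> p0 y"
    and p_nonneg: "0 \<le> p i y"
    and dissipation: "gradient p0 y \<bullet> f (y, ys) + (\<Sum>i\<in>UNIV. p i y - p i (ys $ i))
                        \<le> - \<alpha> * (norm y)\<^sup>2"
begin

abbreviation r :: real where "r \<equiv> max_delay \<tau>"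

lemma max_delay_nonneg: "r \<ge> 0"
  by (rule order_trans[OF delay_nonneg delay_le_max_delay])

lemma p0_cont: "continuous_on UNIV p0"
  using p0_gderiv unfolding gderiv_def
  by (meson continuous_at_imp_continuous_on has_derivative_continuous)

text \<open>The integral of \<open>p i (x s)\<close> over \<open>[t - \<tau> i, t]\<close> is written as a difference of two values
  of one antiderivative, which turns its differentiation into the chain rule. The last
  clause bounds \<open>V 0\<close> by the size of the initial function alone.\<close>

lemma Krasovskii_functional:
  assumes sol: "dde_solution f \<tau> \<phi> x"
  obtains V V' where
    "\<And>t. t \<ge> 0 \<Longrightarrow> (V has_real_derivative V' t) (at t within {0..})"
    "\<And>t. t \<ge> 0 \<Longrightarrow> V' t \<le> - \<alpha> * (norm (x t))\<^sup>2"
    "\<And>t. t \<ge> 0 \<Longrightarrow> \<alpha> * (norm (x t))\<^sup>2 \<le> V t"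
    "\<And>c. (\<And>s. s \<in> {-r..0} \<Longrightarrow> p0 (\<phi> s) \<le> c) \<Longrightarrow>
         (\<And>s i. s \<in> {-r..0} \<Longrightarrow> p i (\<phi> s) \<le> c) \<Longrightarrow> V 0 \<le> c * (1 + (\<Sum>i\<in>UNIV. \<tau> i))"
proof -
  have x_cont: "continuous_on {-r..} x" and x_init: "\<And>s. s \<in> {-r..0} \<Longrightarrow> x s = \<phi> s"
    and x_der: "\<And>t. t \<ge> 0 \<Longrightarrow>
          (x has_vector_derivative f (x t, \<chi> i. x (t - \<tau> i))) (at t within {0..})"
    using sol unfolding dde_solution_def by auto
  have "\<exists>G. \<forall>t\<ge>-r. (G has_real_derivative p i (x t)) (at t within {-r..})" for i
  proof -
    have "continuous_on {-r..} (\<lambda>t. p i (x t))"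
      by (rule continuous_on_compose2[OF p_cont x_cont]) simp
    then show ?thesis using antiderivative_half_line by metis
  qed
  then obtain G where
    G: "\<And>i t. t \<ge> -r \<Longrightarrow> (G i has_real_derivative p i (x t)) (at t within {-r..})"
    by metis
  define V where "V t = p0 (x t) + (\<Sum>i\<in>UNIV. G i t - G i (t - \<tau> i))" for t
  define V' where "V' t = gradient p0 (x t) \<bullet> f (x t, \<chi> i. x (t - \<tau> i))
                     + (\<Sum>i\<in>UNIV. p i (x t) - p i (x (t - \<tau> i)))" for t
  have delay: "t - \<tau> i \<ge> -r" if "t \<ge> 0" for t i
    using that delay_le_max_delay[of \<tau> i] by simp
  show ?thesis
  proof (rule that)
    fix t :: real assume t: "t \<ge> 0"
    let ?v = "f (x t, \<chi> i. x (t - \<tau> i))"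
    have "((\<lambda>t. p0 (x t)) has_derivative (\<lambda>h. (h *\<^sub>R ?v) \<bullet> gradient p0 (x t)))
            (at t within {0..})"
      using has_derivative_compose[OF x_der[OF t, unfolded has_vector_derivative_def]
          p0_gderiv[of "x t", unfolded gderiv_def]] .
    then have d0: "((\<lambda>t. p0 (x t)) has_real_derivative gradient p0 (x t) \<bullet> ?v) (at t within {0..})"
      unfolding has_field_derivative_def
      by (simp add: inner_commute mult.commute[of "gradient p0 (x t) \<bullet> ?v"] mult_commute_abs)
    have d1: "(G i has_real_derivative p i (x t)) (at t within {0..})" for i
      by (rule has_field_derivative_subset[OF G]) (use t max_delay_nonneg in auto)
    have d2: "((\<lambda>t. G i (t - \<tau> i)) has_real_derivative p i (x (t - \<tau> i))) (at t within {0..})"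
      for i
    proof -
      have "(G i has_real_derivative p i (x (t - \<tau> i)))
              (at (t - \<tau> i) within (\<lambda>t. t - \<tau> i) ` {0..})"
        by (rule has_field_derivative_subset[OF G]) (use t delay in auto)
      moreover have "((\<lambda>t. t - \<tau> i) has_real_derivative 1) (at t within {0..})"
        by (auto intro!: derivative_eq_intros)
      ultimately show ?thesis using DERIV_image_chain[of "G i" _ "\<lambda>t. t - \<tau> i"]
        by (fastforce simp: o_def)
    qed
    show "(V has_real_derivative V' t) (at t within {0..})"
      unfolding V_def V'_def by (intro DERIV_add DERIV_sum DERIV_diff d0 d1 d2)
    show "V' t \<le> - \<alpha> * (norm (x t))\<^sup>2"
      using dissipation[of "x t" "\<chi> i. x (t - \<tau> i)"] by (simp add: V'_def)
    have "G i (t - \<tau> i) \<le> G i t" for i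
    proof -
      have "- G i t - - G i (t - \<tau> i) \<le> 0 * (t - (t - \<tau> i))"
      proof (rule has_real_derivative_le_imp_diff_le[where S = "{-r..}"])
        fix s assume "s \<in> {t - \<tau> i..t}"
        then have "s \<ge> -r" using delay[OF t, of i] by simp
        then show "((\<lambda>s. - G i s) has_real_derivative - p i (x s)) (at s within {-r..})"
          by (intro DERIV_minus G)
      qed (use p_nonneg delay_nonneg delay[OF t, of i] in auto)
      then show ?thesis by simp
    qed
    then have "0 \<le> (\<Sum>i\<in>UNIV. G i t - G i (t - \<tau> i))" by (simp add: sum_nonneg)
    then show "\<alpha> * (norm (x t))\<^sup>2 \<le> V t" using p0_ge[of "x t"] by (simp add: V_def)
  next
    fix c assume c0: "\<And>s. s \<in> {-r..0} \<Longrightarrow> p0 (\<phi> s) \<le> c"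
      and c: "\<And>s i. s \<in> {-r..0} \<Longrightarrow> p i (\<phi> s) \<le> c"
    have "G i 0 - G i (0 - \<tau> i) \<le> c * (0 - (0 - \<tau> i))" for i
    proof (rule has_real_derivative_le_imp_diff_le[where S = "{-r..}"])
      fix s assume "s \<in> {0 - \<tau> i..0}"
      then have s: "s \<in> {-r..0}" using delay[of 0 i] by simp
      show "(G i has_real_derivative p i (x s)) (at s within {-r..})" using s by (intro G) simp
      show "p i (x s) \<le> c" using c x_init s by simp
    qed (use delay_nonneg delay[of 0 i] in auto)
    then have "(\<Sum>i\<in>UNIV. G i 0 - G i (0 - \<tau> i)) \<le> (\<Sum>i\<in>UNIV. c * \<tau> i)"
      by (intro sum_mono) simp
    moreover have "p0 (x 0) \<le> c" using c0[of 0] x_init[of 0] max_delay_nonneg by simp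
    ultimately show "V 0 \<le> c * (1 + (\<Sum>i\<in>UNIV. \<tau> i))"
      by (simp add: V_def algebra_simps sum_distrib_left)
  qed
qed

text \<open>Whatever bounds the certificate on the initial function bounds the whole future
  trajectory: boundedness and stability are two instances of this estimate.\<close>

lemma solution_estimate:
  assumes sol: "dde_solution f \<tau> \<phi> x" and "t \<ge> 0"
    and "\<And>s. s \<in> {-r..0} \<Longrightarrow> p0 (\<phi> s) \<le> c" "\<And>s i. s \<in> {-r..0} \<Longrightarrow> p i (\<phi> s) \<le> c"
  shows "\<alpha> * (norm (x t))\<^sup>2 \<le> c * (1 + (\<Sum>i\<in>UNIV. \<tau> i))"
proof -
  obtain V V' where V:
    "\<And>t. t \<ge> 0 \<Longrightarrow> (V has_real_derivative V' t) (at t within {0..})"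
    "\<And>t. t \<ge> 0 \<Longrightarrow> V' t \<le> - \<alpha> * (norm (x t))\<^sup>2"
    "\<And>t. t \<ge> 0 \<Longrightarrow> \<alpha> * (norm (x t))\<^sup>2 \<le> V t"
    "V 0 \<le> c * (1 + (\<Sum>i\<in>UNIV. \<tau> i))"
    using Krasovskii_functional[OF sol] assms(3,4) by metis
  have "V t - V 0 \<le> 0 * (t - 0)"
  proof (rule has_real_derivative_le_imp_diff_le[where S = "{0..}" and g' = V'])
    fix s assume "s \<in> {0..t}"
    then have "V' s \<le> - \<alpha> * (norm (x s))\<^sup>2" using V(2) by simp
    also have "\<dots> \<le> 0" using alpha_pos by simp
    finally show "V' s \<le> 0" .
  qed (use \<open>t \<ge> 0\<close> V(1) in auto)
  then show ?thesis using V(3)[OF \<open>t \<ge> 0\<close>] V(4) by linarith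
qed

lemma solution_bounded:
  assumes hist: "\<phi> \<in> history r" and sol: "dde_solution f \<tau> \<phi> x"
  shows "bounded (x ` {-r..})"
proof -
  have phi_cont: "continuous_on {-r..0} \<phi>" using hist by (simp add: history_def)
  have bdd: "\<exists>B. \<forall>s\<in>{-r..0}. q (\<phi> s) \<le> B" if "continuous_on UNIV q" for q :: "real^'n \<Rightarrow> real"
  proof -
    have "compact ((\<lambda>s. q (\<phi> s)) ` {-r..0})"
      by (intro compact_continuous_image continuous_on_compose2[OF that phi_cont]) auto
    then have "bdd_above ((\<lambda>s. q (\<phi> s)) ` {-r..0})"
      by (intro bounded_imp_bdd_above compact_imp_bounded)
    then show ?thesis by (auto simp: bdd_above_def)
  qed
  obtain B0 where B0: "\<And>s. s \<in> {-r..0} \<Longrightarrow> p0 (\<phi> s) \<le> B0" using bdd[OF p0_cont] by blast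
  obtain B where B: "\<And>s i. s \<in> {-r..0} \<Longrightarrow> p i (\<phi> s) \<le> B i" using bdd[OF p_cont] by metis
  define c where "c = Max (insert B0 (range B))"
  have "B0 \<le> c" "B i \<le> c" for i by (simp_all add: c_def del: Max_insert)
  then have c: "\<And>s. s \<in> {-r..0} \<Longrightarrow> p0 (\<phi> s) \<le> c" "\<And>s i. s \<in> {-r..0} \<Longrightarrow> p i (\<phi> s) \<le> c"
    by (auto intro: order_trans[OF B0] order_trans[OF B])
  define E where "E = sqrt (c * (1 + (\<Sum>i\<in>UNIV. \<tau> i)) / \<alpha>)"
  have future: "norm (x t) \<le> E" if "t \<ge> 0" for t
    unfolding E_def using solution_estimate[OF sol that c] alpha_pos
    by (intro real_le_rsqrt) (simp add: field_simps)
  have "norm (x t) \<le> max E (history_norm r \<phi>)" if "t \<ge> -r" for t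
  proof (cases "t \<ge> 0")
    case True
    then show ?thesis using future[of t] by simp
  next
    case False
    then have "t \<in> {-r..0}" using that by simp
    moreover from this have "x t = \<phi> t" using sol by (simp add: dde_solution_def)
    ultimately show ?thesis using norm_le_history_norm[OF hist] by (simp add: le_max_iff_disj)
  qed
  then show ?thesis by (auto simp: bounded_iff)
qed

lemma solution_stable:
  assumes "\<epsilon> > 0"
  shows "\<exists>\<delta>>0. \<forall>\<phi>\<in>history r. \<forall>x. dde_solution f \<tau> \<phi> x \<longrightarrow> history_norm r \<phi> < \<delta> \<longrightarrow>
           (SUP t\<in>{-r..}. norm (x t)) < \<epsilon>"
proof -
  \<comment> \<open>Passing to \<open>\<eta> < \<epsilon>\<close> keeps the inequality strict under the supremum.\<close>
  define \<eta> where "\<eta> = \<epsilon> / 2"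
  have "\<eta> > 0" "\<eta> < \<epsilon>" using assms by (auto simp: \<eta>_def)
  define S where "S = 1 + (\<Sum>i\<in>UNIV. \<tau> i)"
  have "S > 0" using sum_nonneg[of UNIV \<tau>] delay_nonneg by (simp add: S_def)
  define c where "c = \<alpha> * \<eta>\<^sup>2 / S"
  have "c > 0" and cS: "c * S = \<alpha> * \<eta>\<^sup>2"
    using alpha_pos \<open>\<eta> > 0\<close> \<open>S > 0\<close> by (auto simp: c_def)
  have small: "\<forall>\<^sub>F y in nhds 0. q y < c" if "continuous_on UNIV q" "q 0 = 0"
    for q :: "real^'n \<Rightarrow> real"
  proof -
    have "(q \<longlongrightarrow> q 0) (nhds 0)"
      using that(1) by (simp add: continuous_on_eq_continuous_at isCont_def tendsto_nhds_iff)
    then show ?thesis using order_tendstoD(2) \<open>c > 0\<close> that(2) by metis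
  qed
  have "\<forall>\<^sub>F y in nhds 0. p0 y < c \<and> (\<forall>i\<in>UNIV. p i y < c)"
    by (intro eventually_conj eventually_ball_finite ballI finite small p0_cont p_cont
        p0_zero p_zero)
  then obtain \<delta>\<^sub>0 where "\<delta>\<^sub>0 > 0" and
    \<delta>\<^sub>0: "\<And>y. norm y < \<delta>\<^sub>0 \<Longrightarrow> p0 y < c" "\<And>y i. norm y < \<delta>\<^sub>0 \<Longrightarrow> p i y < c"
    unfolding eventually_nhds_metric by (auto simp: dist_norm)
  show ?thesis
  proof (intro exI[of _ "min \<delta>\<^sub>0 \<eta>"] conjI ballI allI impI)
    fix \<phi> x assume hist: "\<phi> \<in> history r" and sol: "dde_solution f \<tau> \<phi> x"
      and less: "history_norm r \<phi> < min \<delta>\<^sub>0 \<eta>"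
    have phi: "norm (\<phi> s) < min \<delta>\<^sub>0 \<eta>" if "s \<in> {-r..0}" for s
      using norm_le_history_norm[OF hist that] less by linarith
    have "norm (x t) \<le> \<eta>" if "t \<ge> -r" for t
    proof (cases "t \<ge> 0")
      case True
      have "\<alpha> * (norm (x t))\<^sup>2 \<le> c * S"
        unfolding S_def using phi \<delta>\<^sub>0
        by (intro solution_estimate[OF sol True]) (auto intro: less_imp_le)
      then have "(norm (x t))\<^sup>2 \<le> \<eta>\<^sup>2" using cS alpha_pos by simp
      then show ?thesis using \<open>\<eta> > 0\<close> power2_le_imp_le by fastforce
    next
      case False
      then have t: "t \<in> {-r..0}" using that by simp
      then have "x t = \<phi> t" using sol by (simp add: dde_solution_def)
      then show ?thesis using phi[OF t] by simp
    qed
    then have "(SUP t\<in>{-r..}. norm (x t)) \<le> \<eta>" by (intro cSUP_least) auto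
    then show "(SUP t\<in>{-r..}. norm (x t)) < \<epsilon>" using \<open>\<eta> < \<epsilon>\<close> by simp
  qed (use \<open>\<delta>\<^sub>0 > 0\<close> \<open>\<eta> > 0\<close> in auto)
qed

lemma solution_tendsto_zero:
  assumes hist: "\<phi> \<in> history r" and sol: "dde_solution f \<tau> \<phi> x"
  shows "(x \<longlongrightarrow> 0) at_top"
proof -
  obtain R where R: "\<And>s. s \<ge> -r \<Longrightarrow> norm (x s) \<le> R"
    using solution_bounded[OF assms] by (auto simp: bounded_iff)
  have "compact (f ` cball 0 (R + CARD('k) * R))"
    by (intro compact_continuous_image continuous_on_subset[OF f_cont]) auto
  then obtain L where "\<forall>y\<in>f ` cball 0 (R + CARD('k) * R). norm y \<le> L"
    using compact_imp_bounded bounded_iff by metis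
  then have L: "norm (f z) \<le> L" if "norm z \<le> R + CARD('k) * R" for z
    using that by (simp only: ball_simps mem_cball_0)
  have lip: "norm (x s - x t) \<le> L * \<bar>s - t\<bar>" if "s \<ge> 0" "t \<ge> 0" for s t
  proof (rule vector_derivative_bound_imp_lipschitz[where a = 0])
    fix u :: real assume u: "u \<ge> 0"
    then show "(x has_vector_derivative f (x u, \<chi> i. x (u - \<tau> i))) (at u within {0..})"
      using sol by (simp add: dde_solution_def)
    show "norm (f (x u, \<chi> i. x (u - \<tau> i))) \<le> L"
      by (rule L, rule norm_delayed_state_le) (use R u delay_nonneg in auto)
  qed (use that in auto)
  obtain V V' where V:
    "\<And>t. t \<ge> 0 \<Longrightarrow> (V has_real_derivative V' t) (at t within {0..})"
    "\<And>t. t \<ge> 0 \<Longrightarrow> V' t \<le> - \<alpha> * (norm (x t))\<^sup>2"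
    "\<And>t. t \<ge> 0 \<Longrightarrow> \<alpha> * (norm (x t))\<^sup>2 \<le> V t"
    using Krasovskii_functional[OF sol] by metis
  have "0 \<le> V t" if "t \<ge> 0" for t
    by (rule order_trans[OF _ V(3)[OF that]]) (use alpha_pos in simp)
  then show ?thesis
    using dissipation_imp_tendsto_zero[OF alpha_pos V(1) V(2) _ lip] by simp
qed

lemma globally_asymptotically_stable: "globally_asymptotically_stable f \<tau>"
  unfolding globally_asymptotically_stable_def
  using solution_bounded solution_stable solution_tendsto_zero by blast

end

section \<open>Stability from a sum-of-squares certificate\<close>

theorem mainTheorem10:
  fixes f :: "(real^'n) \<times> (real^'n^'k) \<Rightarrow> real^'n"
    and d :: int
  assumes f_cont: "continuous_on UNIV f"
    and f_zero: "f (0, \<chi> i. 0) = 0"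
    and certificate:
      "\<exists>(p0 :: real^'n \<Rightarrow> real) (p :: 'k \<Rightarrow> real^'n \<Rightarrow> real) (\<alpha> :: real).
         real_polynomial_function p0 \<and> (\<forall>i. real_polynomial_function (p i)) \<and> \<alpha> > 0 \<and>
         p0 0 = 0 \<and> (\<forall>i. p i 0 = 0) \<and>
         (\<lambda>x0. p0 x0 - \<alpha> * (norm x0)\<^sup>2) \<in> sos_le d \<and>
         (\<forall>i. p i \<in> sos_le d) \<and>
         (\<lambda>(x0, xs :: real^'n^'k). - (gradient p0 x0 \<bullet> f (x0, xs))
              - (\<Sum>i\<in>UNIV. p i x0 - p i (xs $ i)) - \<alpha> * (norm x0)\<^sup>2) \<in> sos"
  shows "\<forall>\<tau> :: 'k \<Rightarrow> real. (\<forall>i. \<tau> i \<ge> 0) \<longrightarrow> dde_well_posed f \<tau> \<longrightarrow>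
           globally_asymptotically_stable f \<tau>"
proof (intro allI impI)
  fix \<tau> :: "'k \<Rightarrow> real" assume delays: "\<forall>i. \<tau> i \<ge> 0"
  obtain p0 p \<alpha> where
    poly: "real_polynomial_function p0" "\<And>i. real_polynomial_function (p i)"
    and "\<alpha> > 0" and zero: "p0 0 = 0" "\<And>i. p i 0 = 0"
    and p0_sos: "(\<lambda>x0. p0 x0 - \<alpha> * (norm x0)\<^sup>2) \<in> sos_le d"
    and p_sos: "\<And>i. p i \<in> sos_le d"
    and diss_sos: "(\<lambda>(x0, xs :: real^'n^'k). - (gradient p0 x0 \<bullet> f (x0, xs))
              - (\<Sum>i\<in>UNIV. p i x0 - p i (xs $ i)) - \<alpha> * (norm x0)\<^sup>2) \<in> sos"
    using certificate by (elim exE conjE) (rule that; simp)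
  interpret Krasovskii_certificate f \<tau> p0 p \<alpha>
  proof
    show "GDERIV p0 y :> gradient p0 y" for y
      by (rule GDERIV_gradient) (rule differentiable_at_real_polynomial_function[OF poly(1)])
    show "continuous_on UNIV (p i)" for i
      using differentiable_on_real_polynomial_function[OF poly(2)]
      by (rule differentiable_imp_continuous_on)
    show "\<alpha> * (norm y)\<^sup>2 \<le> p0 y" for y
      using sos_nonneg[of "\<lambda>x0. p0 x0 - \<alpha> * (norm x0)\<^sup>2" y] p0_sos by (simp add: sos_le_def)
    show "0 \<le> p i y" for i y
      using sos_nonneg[of "p i" y] p_sos[of i] by (simp add: sos_le_def)
    show "gradient p0 y \<bullet> f (y, ys) + (\<Sum>i\<in>UNIV. p i y - p i (ys $ i)) \<le> - \<alpha> * (norm y)\<^sup>2"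
      for y and ys :: "real^'n^'k"
      using sos_nonneg[OF diss_sos, of "(y, ys)"] by simp
  qed (use f_cont delays \<open>\<alpha> > 0\<close> zero in auto)
  show "globally_asymptotically_stable f \<tau>" by (rule globally_asymptotically_stable)
qed

end
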